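(* Suppose the selector follows the Plackett–Luce recovery curve with strength $\lambda\ge1$. Let $\mathcal M$ be a nonempty finite workflow pool and $\mathcal K\subseteq\{1,\dots,K_{\max}\}$ a nonempty cardinality grid. For each $k\in\mathcal K$, let $\boldsymbol M_k^{\mathrm{RR}}$ be obtained by applying with-replacement rounding to an optimal solution of the size-$k$ LP. Assume a feasible baseline vector $\boldsymbol m^0\in\mathbb Z_+^{\mathcal M}$ is retained with $\Pi_{\lambda,\gamma}(\boldsymbol m^0)\ge\underline V>0$. After rounding, choose $$\widehat{\boldsymbol M}\in\operatorname*{arg\,max}_{S\in\{\boldsymbol m^0\}\cup\{\boldsymbol M_k^{\mathrm{RR}}:k\in\mathcal K\}}\Pi_{\lambda,\gamma}(S).$$ Then $$\mathbb E\big[\Pi_{\lambda,\gamma}(\widehat{\boldsymbol M})\big]\ge\max\big\{\underline V,\ U_{\mathrm{LP}}(\mathcal K;\mathcal M)-\varepsilon_{\mathrm{rnd}}(\mathcal K,\lambda)\big\}\ge\frac{\underline V}{\underline V+\varepsilon_{\mathrm{rnd}}(\mathcal K,\lambda)}\,U_{\mathrm{LP}}(\mathcal K;\mathcal M).$$ Moreover, if the size-$k$ integer programs are solved exactly instead (i.e. each $\boldsymbol M_k^{\mathrm{RR}}$ is replaced by a maximizer of $\Pi_{\lambda,\gamma}$ over $\{\boldsymbol m\in\mathbb Z_+^{\mathcal M}:k(\boldsymbol m)=k\}$), the same guarantee holds without the expectation.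
   Context: Setting. There are $n\ge1$ tasks $i=1,\dots,n$, workflow types $g\in\mathcal M$, correctness indicators $a_{ig}\in\{0,1\}$, costs $c_g\ge0$, cost price $\gamma\ge0$, integer $K_{\max}\ge1$. For $\boldsymbol m\in\mathbb Z_+^{\mathcal M}$: $k(\boldsymbol m)=\sum_gm_g$, $r_i(\boldsymbol m)=\sum_ga_{ig}m_g$, $C(\boldsymbol m)=\sum_gc_gm_g$; feasible means $k(\boldsymbol m)\le K_{\max}$. Plackett–Luce recovery curve: $\psi_k(r)=\frac{\lambda r}{k+(\lambda-1)r}=h_\lambda(r/k)$, $r=0,\dots,k$, where $h_\lambda(p)=\frac{\lambda p}{1+(\lambda-1)p}$. Net value: $\Pi_{\lambda,\gamma}(\boldsymbol m)=\frac1n\sum_ih_\lambda(r_i(\boldsymbol m)/k(\boldsymbol m))-\gamma C(\boldsymbol m)$ for $\boldsymbol m\ne\boldsymbol 0$, and $\Pi_{\lambda,\gamma}(\boldsymbol 0)=0$. Let $d_{\ell,k}=\psi_k(\ell)-\psi_k(\ell-1)$. The size-$k$ LP, with optimal value $L_k(\mathcal M)$, is: maximize $\frac1n\sum_i\sum_{\ell=1}^kd_{\ell,k}y_{i\ell}-\gamma\sum_gc_gz_g$ subject to $\sum_{\ell}y_{i\ell}\le\sum_ga_{ig}z_g$ for all $i$, $y_{i\ell}\le y_{i,\ell-1}$ for $\ell=2,\dots,k$, $\sum_gz_g=k$, $z_g\ge0$, $0\le y_{i\ell}\le1$. With-replacement rounding of $z$: draw $G_1,\dots,G_k$ i.i.d.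 with $\Pr(G_j=g)=z_g/k$ and set $M^{\mathrm{RR}}_{k,g}=\sum_{j=1}^k\mathbf 1\{G_j=g\}$. Grid LP benchmark: $U_{\mathrm{LP}}(\mathcal K;\mathcal M)=\max\{0,\max_{k\in\mathcal K}L_k(\mathcal M)\}$. Plackett–Luce curvature: $c^{\mathrm{PL}}_{k,\lambda}=1-\frac{d_{k,k}}{d_{1,k}}=1-\frac{k+\lambda-1}{\lambda\{k+(\lambda-1)(k-1)\}}$, which is nondecreasing in $k$. Rounding loss: $\varepsilon_{\mathrm{rnd}}(\mathcal K,\lambda)=\frac1e c^{\mathrm{PL}}_{\bar k,\lambda}=\frac1e\max_{k\in\mathcal K}c^{\mathrm{PL}}_{k,\lambda}$ with $\bar k=\max\mathcal K$. *)

theory Defs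
  imports "HOL-Probability.Probability"
begin

text \<open>
  Tasks are \<open>1, \<dots>, n\<close>, the workflow pool is a set \<open>M\<close>, \<open>a i g\<close> is the correctness indicator
  and \<open>c g\<close> the cost. A vector in $\mathbb{Z}_+^M$ is a function \<open>m :: 'g \<Rightarrow> nat\<close> of which
  only the restriction to \<open>M\<close> is ever inspected; likewise for the LP variables.
\<close>

definition wsize :: "'g set \<Rightarrow> ('g \<Rightarrow> nat) \<Rightarrow> nat" where
  "wsize M m = (\<Sum>g\<in>M. m g)"

definition num_correct :: "'g set \<Rightarrow> (nat \<Rightarrow> 'g \<Rightarrow> nat) \<Rightarrow> nat \<Rightarrow> ('g \<Rightarrow> nat) \<Rightarrow> nat" where
  "num_correct M a i m = (\<Sum>g\<in>M. a i g * m g)"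

definition wcost :: "'g set \<Rightarrow> ('g \<Rightarrow> real) \<Rightarrow> ('g \<Rightarrow> nat) \<Rightarrow> real" where
  "wcost M c m = (\<Sum>g\<in>M. c g * real (m g))"

definition PL_h :: "real \<Rightarrow> real \<Rightarrow> real" where
  "PL_h lam p = lam * p / (1 + (lam - 1) * p)"

definition PL_psi :: "real \<Rightarrow> nat \<Rightarrow> nat \<Rightarrow> real" where
  "PL_psi lam k r = lam * real r / (real k + (lam - 1) * real r)"

definition PL_d :: "real \<Rightarrow> nat \<Rightarrow> nat \<Rightarrow> real" where
  "PL_d lam l k = PL_psi lam k l - PL_psi lam k (l - 1)"

definition net_value ::
  "nat \<Rightarrow> 'g set \<Rightarrow> (nat \<Rightarrow> 'g \<Rightarrow> nat) \<Rightarrow> ('g \<Rightarrow> real) \<Rightarrow> real \<Rightarrow> real \<Rightarrow> ('g \<Rightarrow> nat) \<Rightarrow> real" where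
  "net_value n M a c lam \<gamma> m =
     (if \<forall>g\<in>M. m g = 0 then 0
      else 1 / real n * (\<Sum>i=1..n. PL_h lam (real (num_correct M a i m) / real (wsize M m)))
           - \<gamma> * wcost M c m)"

definition LP_feasible ::
  "nat \<Rightarrow> 'g set \<Rightarrow> (nat \<Rightarrow> 'g \<Rightarrow> nat) \<Rightarrow> nat \<Rightarrow> (nat \<Rightarrow> nat \<Rightarrow> real) \<times> ('g \<Rightarrow> real) \<Rightarrow> bool" where
  "LP_feasible n M a k = (\<lambda>(y, z).
     (\<forall>i\<in>{1..n}. (\<Sum>l=1..k. y i l) \<le> (\<Sum>g\<in>M. real (a i g) * z g)) \<and>
     (\<forall>i\<in>{1..n}. \<forall>l\<in>{2..k}. y i l \<le> y i (l - 1)) \<and>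
     (\<Sum>g\<in>M. z g) = real k \<and>
     (\<forall>g\<in>M. 0 \<le> z g) \<and>
     (\<forall>i\<in>{1..n}. \<forall>l\<in>{1..k}. 0 \<le> y i l \<and> y i l \<le> 1))"

definition LP_objective ::
  "nat \<Rightarrow> 'g set \<Rightarrow> ('g \<Rightarrow> real) \<Rightarrow> real \<Rightarrow> real \<Rightarrow> nat \<Rightarrow>
   (nat \<Rightarrow> nat \<Rightarrow> real) \<times> ('g \<Rightarrow> real) \<Rightarrow> real" where
  "LP_objective n M c lam \<gamma> k = (\<lambda>(y, z).
     1 / real n * (\<Sum>i=1..n. \<Sum>l=1..k. PL_d lam l k * y i l) - \<gamma> * (\<Sum>g\<in>M. c g * z g))"

text \<open>
  The feasible region is nonempty and, on the relevant coordinates, compact, so this supremum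
  is the attained optimal value.
\<close>

definition LP_value ::
  "nat \<Rightarrow> 'g set \<Rightarrow> (nat \<Rightarrow> 'g \<Rightarrow> nat) \<Rightarrow> ('g \<Rightarrow> real) \<Rightarrow> real \<Rightarrow> real \<Rightarrow> nat \<Rightarrow> real" where
  "LP_value n M a c lam \<gamma> k =
     Sup (LP_objective n M c lam \<gamma> k ` {yz. LP_feasible n M a k yz})"

definition LP_optimal ::
  "nat \<Rightarrow> 'g set \<Rightarrow> (nat \<Rightarrow> 'g \<Rightarrow> nat) \<Rightarrow> ('g \<Rightarrow> real) \<Rightarrow> real \<Rightarrow> real \<Rightarrow> nat \<Rightarrow>
   (nat \<Rightarrow> nat \<Rightarrow> real) \<times> ('g \<Rightarrow> real) \<Rightarrow> bool" where
  "LP_optimal n M a c lam \<gamma> k =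
     is_arg_max (LP_objective n M c lam \<gamma> k) (LP_feasible n M a k)"

definition U_LP ::
  "nat \<Rightarrow> (nat \<Rightarrow> 'g \<Rightarrow> nat) \<Rightarrow> ('g \<Rightarrow> real) \<Rightarrow> real \<Rightarrow> real \<Rightarrow> nat set \<Rightarrow> 'g set \<Rightarrow> real" where
  "U_LP n a c lam \<gamma> K M = max 0 (Max (LP_value n M a c lam \<gamma> ` K))"

definition PL_curvature :: "real \<Rightarrow> nat \<Rightarrow> real" where
  "PL_curvature lam k = 1 - PL_d lam k k / PL_d lam 1 k"

definition rounding_loss :: "nat set \<Rightarrow> real \<Rightarrow> real" where
  "rounding_loss K lam = 1 / exp 1 * PL_curvature lam (Max K)"

text \<open>The draws \<open>G 1, \<dots>, G k\<close> are i.i.d. on the probability space \<open>P\<close> with law \<open>z / k\<close> on \<open>M\<close>.\<close>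

definition rr_draws ::
  "'w measure \<Rightarrow> 'g set \<Rightarrow> nat \<Rightarrow> ('g \<Rightarrow> real) \<Rightarrow> (nat \<Rightarrow> 'w \<Rightarrow> 'g) \<Rightarrow> bool" where
  "rr_draws P M k z G \<longleftrightarrow>
     prob_space.indep_vars P (\<lambda>_. count_space M) G {1..k} \<and>
     (\<forall>j\<in>{1..k}. \<forall>g\<in>M. measure P {w \<in> space P. G j w = g} = z g / real k)"

definition rr_vector :: "nat \<Rightarrow> (nat \<Rightarrow> 'w \<Rightarrow> 'g) \<Rightarrow> 'w \<Rightarrow> 'g \<Rightarrow> nat" where
  "rr_vector k G w g = (\<Sum>j=1..k. of_bool (G j w = g))"

lemma PL_psi_eq_PL_h:
  assumes "k \<ge> 1"
  shows "PL_psi lam k r = PL_h lam (real r / real k)"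
proof -
  have "1 + (lam - 1) * (real r / real k) = (real k + (lam - 1) * real r) / real k"
    using assms by (simp add: field_simps)
  then show ?thesis
    using assms unfolding PL_psi_def PL_h_def by simp
qed

lemma PL_curvature_closed_form:
  assumes "lam \<ge> 1" "k \<ge> 1"
  shows "PL_curvature lam k =
    1 - (real k + lam - 1) / (lam * (real k + (lam - 1) * (real k - 1)))"
proof -
  define D where "D = real k + (lam - 1) * (real k - 1)"
  have D: "D > 0"
    using assms unfolding D_def by (intro add_pos_nonneg mult_nonneg_nonneg) auto
  have kk: "real k + (lam - 1) * real k = lam * real k"
    by (simp add: algebra_simps)
  have "PL_d lam k k = 1 - lam * (real k - 1) / D"
    using assms unfolding PL_d_def PL_psi_def D_def kk by (simp add: of_nat_diff)
  also have "\<dots> = (D - lam * (real k - 1)) / D"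
    using D by (simp add: diff_divide_distrib)
  also have "D - lam * (real k - 1) = 1"
    unfolding D_def by (simp add: algebra_simps)
  finally have 1: "PL_d lam k k = 1 / D" .
  have 2: "PL_d lam 1 k = lam / (real k + lam - 1)"
    unfolding PL_d_def PL_psi_def by (simp add: algebra_simps)
  show ?thesis
    unfolding PL_curvature_def 1 2 D_def[symmetric] by simp
qed

lemma PL_curvature_mono:
  assumes "lam \<ge> 1" "1 \<le> j" "j \<le> k"
  shows "PL_curvature lam j \<le> PL_curvature lam k"
proof -
  define D where "D x = x + (lam - 1) * (x - 1)" for x :: real
  have D: "D (real i) > 0" if "i \<ge> 1" for i
    using assms(1) that unfolding D_def by (intro add_pos_nonneg mult_nonneg_nonneg) auto
  have "(real j + lam - 1) * D (real k) - (real k + lam - 1) * D (real j)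
      = (real k - real j) * ((lam - 1) * (lam + 1))"
    unfolding D_def by (simp add: algebra_simps)
  moreover have "\<dots> \<ge> 0"
    using assms by (intro mult_nonneg_nonneg) auto
  ultimately have le: "(real k + lam - 1) * D (real j) \<le> (real j + lam - 1) * D (real k)"
    by linarith
  have Dk: "D (real k) > 0" and Dj: "D (real j) > 0"
    using D assms by auto
  have "(real k + lam - 1) / D (real k) \<le> (real j + lam - 1) / D (real j)"
    using le Dk Dj by (simp add: divide_simps mult.commute)
  then have "(real k + lam - 1) / D (real k) / lam \<le> (real j + lam - 1) / D (real j) / lam"
    using assms(1) by (intro divide_right_mono) auto
  then show ?thesis
    using assms by (simp add: PL_curvature_closed_form D_def mult.commute)
qed

lemma rounding_loss_eq_Max:
  assumes "lam \<ge> 1" "finite K" "K \<noteq> {}" "\<And>k. k \<in> K \<Longrightarrow> 1 \<le> k"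
  shows "rounding_loss K lam = 1 / exp 1 * Max (PL_curvature lam ` K)"
proof -
  have "Max (PL_curvature lam ` K) = PL_curvature lam (Max K)"
    using assms by (intro Max_eqI) (auto intro!: PL_curvature_mono)
  then show ?thesis
    by (simp add: rounding_loss_def)
qed

end

theory Submission
  imports Defs
begin

text \<open>
  Fix a task with recovery curve \<open>\<psi>\<close> and an LP solution \<open>(y, z)\<close>, and write \<open>s = \<Sum>g. a g * z g\<close>.
  Split \<open>\<psi> r = d\<^sub>k * r + g r\<close>, where \<open>d\<^sub>k\<close> is the last increment. Rounding preserves the mean of the
  linear part. The remainder \<open>g\<close> is concave and nondecreasing, and its share \<open>Y\<close> of the LP objective
  is bounded by \<open>g r + s * (g (r + 1) - g r)\<close> for every \<open>r < k\<close>; hence each draw closes on average at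
  least a fraction \<open>1 / k\<close> of the gap to \<open>Y\<close>, and \<open>k\<close> draws lose at most \<open>(1 - 1 / k) ^ k * Y \<le> Y / e\<close>.
  Finally \<open>Y \<le> g k = 1 - k * d\<^sub>k\<close>, which is at most the curvature because \<open>k * d\<^sub>1 \<ge> 1\<close>.
\<close>

section \<open>The Plackett--Luce increments\<close>

context
  fixes lam :: real and k :: nat
  assumes lam: "lam \<ge> 1" and k: "k \<ge> 1"
begin

lemma PL_denominator_pos: "real k + (lam - 1) * real r > 0"
  using lam k by (intro add_pos_nonneg mult_nonneg_nonneg) auto

text \<open>Over a common denominator the numerator collapses to \<open>lam * real k\<close>,
  independent of \<open>l\<close>, so sign and monotonicity of the increments can be read off the
  two denominator factors.\<close>

lemma PL_d_eq:
  assumes "l \<ge> 1"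
  shows "PL_d lam l k =
    lam * real k / ((real k + (lam - 1) * real l) * (real k + (lam - 1) * real (l - 1)))"
proof -
  have "real k + (lam - 1) * real l \<noteq> 0" "real k + (lam - 1) * real (l - 1) \<noteq> 0"
    using PL_denominator_pos[of l] PL_denominator_pos[of "l - 1"] by linarith+
  then have "PL_d lam l k =
      (lam * real l * (real k + (lam - 1) * real (l - 1))
         - lam * real (l - 1) * (real k + (lam - 1) * real l))
      / ((real k + (lam - 1) * real l) * (real k + (lam - 1) * real (l - 1)))"
    unfolding PL_d_def PL_psi_def by (subst diff_frac_eq) auto
  also have "lam * real l * (real k + (lam - 1) * real (l - 1))
      - lam * real (l - 1) * (real k + (lam - 1) * real l) = lam * real k"
    using assms by (simp add: of_nat_diff algebra_simps)
  finally show ?thesis .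
qed

lemma PL_d_pos: "l \<ge> 1 \<Longrightarrow> PL_d lam l k > 0"
  unfolding PL_d_eq by (intro divide_pos_pos mult_pos_pos PL_denominator_pos) (use lam k in auto)

text \<open>Concavity of the recovery curve: since \<open>lam \<ge> 1\<close>, both denominator
  factors of the closed form grow with \<open>l\<close>.\<close>

lemma PL_d_antimono:
  assumes "1 \<le> l" "l \<le> l'"
  shows "PL_d lam l' k \<le> PL_d lam l k"
proof -
  have "(lam - 1) * real l \<le> (lam - 1) * real l'"
    "(lam - 1) * real (l - 1) \<le> (lam - 1) * real (l' - 1)"
    using assms lam by (auto intro!: mult_left_mono)
  then have "(real k + (lam - 1) * real l) * (real k + (lam - 1) * real (l - 1))
      \<le> (real k + (lam - 1) * real l') * (real k + (lam - 1) * real (l' - 1))"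
    using PL_denominator_pos[of l] PL_denominator_pos[of l'] PL_denominator_pos[of "l - 1"]
    by (intro mult_mono) auto
  moreover have "1 \<le> l'"
    using assms by simp
  ultimately show ?thesis
    unfolding PL_d_eq[OF assms(1)] PL_d_eq[OF \<open>1 \<le> l'\<close>]
    using PL_denominator_pos lam k by (intro frac_le mult_pos_pos) auto
qed

lemma sum_PL_d: "(\<Sum>l=1..r. PL_d lam l k) = PL_psi lam k r"
  by (induction r) (simp_all add: PL_d_def PL_psi_def)

lemma PL_psi_full: "PL_psi lam k k = 1"
proof -
  have "real k + (lam - 1) * real k = lam * real k"
    by (simp add: algebra_simps)
  then show ?thesis
    using lam k by (simp add: PL_psi_def)
qed

lemma PL_curvature_nonneg: "PL_curvature lam k \<ge> 0"
  using PL_d_antimono[of 1 k] PL_d_pos[of 1] k by (simp add: PL_curvature_def)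

text \<open>The \<open>k\<close> increments add up to 1 and the first is the largest, so
  \<open>1 / PL_d lam 1 k\<close> is at most \<open>k\<close>. Multiplied by the last increment,
  this bounds the ratio in the curvature.\<close>

lemma one_minus_last_increments_le_curvature: "1 - real k * PL_d lam k k \<le> PL_curvature lam k"
proof -
  have "1 = (\<Sum>l=1..k. PL_d lam l k)"
    by (simp only: sum_PL_d PL_psi_full)
  also have "\<dots> \<le> (\<Sum>l=1..k. PL_d lam 1 k)"
    by (intro sum_mono PL_d_antimono) auto
  finally have "1 / PL_d lam 1 k \<le> real k"
    using PL_d_pos[of 1] by (simp add: field_simps)
  then have "PL_d lam k k * (1 / PL_d lam 1 k) \<le> PL_d lam k k * real k"
    using PL_d_pos[of k] k by (intro mult_left_mono) auto
  then show ?thesis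
    by (simp add: PL_curvature_def mult.commute)
qed

end

section \<open>Concave functions of sums of independent indicators\<close>

lemma one_minus_inverse_power_le_exp:
  assumes "k \<ge> 1"
  shows "(1 - 1 / real k) ^ k \<le> 1 / exp 1"
proof -
  have "(1 - 1 / real k) ^ k \<le> exp (- (1 / real k)) ^ k"
    using assms exp_ge_add_one_self[of "- (1 / real k)"] by (intro power_mono) auto
  also have "\<dots> = 1 / exp 1"
    using assms by (simp flip: exp_of_nat_mult add: exp_minus field_simps)
  finally show ?thesis .
qed

text \<open>Weak duality with price \<open>e (Suc r)\<close> on the budget \<open>s\<close>: a level
  up to \<open>r\<close> has a nonnegative surplus over the price and earns most at
  \<open>y l = 1\<close>, a later level has no positive surplus and earns most at
  \<open>y l = 0\<close>.\<close>

lemma tangent_bound: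
  fixes e y :: "nat \<Rightarrow> real"
  assumes antimono: "\<And>l l'. 1 \<le> l \<Longrightarrow> l \<le> l' \<Longrightarrow> l' \<le> k \<Longrightarrow> e l' \<le> e l"
    and nonneg: "\<And>l. 1 \<le> l \<Longrightarrow> l \<le> k \<Longrightarrow> 0 \<le> e l"
    and y: "\<And>l. l \<in> {1..k} \<Longrightarrow> 0 \<le> y l \<and> y l \<le> 1" "(\<Sum>l=1..k. y l) \<le> s"
    and r: "r < k"
  shows "(\<Sum>l=1..k. e l * y l) \<le> (\<Sum>l=1..r. e l) + s * e (Suc r)"
proof -
  \<comment> \<open>The surplus of an early level is bounded by all of \<open>e l\<close>; the
    discarded amount \<open>e (Suc r)\<close> is nonnegative.\<close>
  have "e l * y l \<le> e (Suc r) * y l + (if l \<le> r then e l else 0)" if "l \<in> {1..k}" for l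
  proof (cases "l \<le> r")
    case True
    have "(e l - e (Suc r)) * y l \<le> (e l - e (Suc r)) * 1"
      using True that y(1)[OF that] antimono[of l "Suc r"] r by (intro mult_left_mono) auto
    then show ?thesis
      using True nonneg[of "Suc r"] r by (simp add: algebra_simps)
  next
    case False
    then show ?thesis
      using that y(1)[OF that] antimono[of "Suc r" l] r by (simp add: mult_right_mono)
  qed
  then have "(\<Sum>l=1..k. e l * y l)
      \<le> (\<Sum>l=1..k. e (Suc r) * y l + (if l \<le> r then e l else 0))"
    by (rule sum_mono)
  also have "\<dots> = e (Suc r) * (\<Sum>l=1..k. y l) + (\<Sum>l=1..k. if l \<le> r then e l else 0)"
    by (simp add: sum.distrib sum_distrib_left)
  also have "(\<Sum>l=1..k. if l \<le> r then e l else 0) = (\<Sum>l=1..r. e l)"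
    using r by (intro sum.mono_neutral_cong_right) auto
  also have "e (Suc r) * (\<Sum>l=1..k. y l) \<le> e (Suc r) * s"
    using y(2) nonneg[of "Suc r"] r by (intro mult_left_mono) auto
  finally show ?thesis
    by (simp add: mult.commute)
qed

section \<open>Bounded integer-valued random variables and the contraction of the gap\<close>

context prob_space
begin

lemma integrable_bounded_nat:
  fixes f :: "nat \<Rightarrow> real"
  assumes [measurable]: "X \<in> measurable M (count_space UNIV)"
    and "\<And>w. w \<in> space M \<Longrightarrow> X w \<le> N"
  shows "integrable M (\<lambda>w. f (X w))"
proof (rule integrable_const_bound[where B = "\<Sum>i\<le>N. \<bar>f i\<bar>"])
  have "\<bar>f (X w)\<bar> \<le> (\<Sum>i\<le>N. \<bar>f i\<bar>)" if "w \<in> space M" for w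
    using assms(2)[OF that] by (intro member_le_sum) auto
  then show "AE w in M. norm (f (X w)) \<le> (\<Sum>i\<le>N. \<bar>f i\<bar>)"
    by (intro AE_I2) simp
qed measurable

text \<open>The sum is recovered from its real counterpart by rounding down, so measurability of
  real sums applies.\<close>

lemma sum_nat_measurable:
  fixes B :: "nat \<Rightarrow> 'a \<Rightarrow> nat"
  assumes "\<And>t. t \<in> I \<Longrightarrow> B t \<in> measurable M (count_space UNIV)"
  shows "(\<lambda>w. \<Sum>t\<in>I. B t w) \<in> measurable M (count_space UNIV)"
proof -
  have "(\<lambda>w. nat \<lfloor>\<Sum>t\<in>I. real (B t w)\<rfloor>) \<in> measurable M (count_space UNIV)"
    using assms by measurable
  then show ?thesis
    by (simp flip: of_nat_sum)
qed

text \<open>The draw \<open>B (Suc j)\<close> is not among the first \<open>j\<close>, hence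
  independent of any function of their sum. This lets the mean gain of a draw be computed as a
  product.\<close>

lemma indep_partial_sum:
  fixes B :: "nat \<Rightarrow> 'a \<Rightarrow> nat" and f :: "nat \<Rightarrow> real"
  assumes indep: "indep_vars (\<lambda>_. count_space UNIV) B {1..k}" and j: "j < k"
    and B: "\<And>t w. t \<in> {1..k} \<Longrightarrow> w \<in> space M \<Longrightarrow> B t w \<le> 1"
  shows "expectation (\<lambda>w. real (B (Suc j) w) * f (\<Sum>t=1..j. B t w))
    = expectation (\<lambda>w. real (B (Suc j) w)) * expectation (\<lambda>w. f (\<Sum>t=1..j. B t w))"
proof -
  have "indep_vars (\<lambda>_. borel) (\<lambda>t w. real (B t w)) {1..k}"
    by (rule indep_vars_compose2[OF indep]) auto
  then have "indep_vars (\<lambda>_. borel) (\<lambda>t w. real (B t w)) (insert (Suc j) {1..j})"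
    by (rule indep_vars_subset) (use j in auto)
  then have "indep_var borel (\<lambda>w. real (B (Suc j) w)) borel (\<lambda>w. \<Sum>t=1..j. real (B t w))"
    by (intro indep_vars_sum) auto
  \<comment> \<open>Composition with \<open>nat \<lfloor>x\<rfloor>\<close> extends \<open>f\<close>
    to a Borel function on the reals that agrees with it on the partial sums.\<close>
  then have "indep_var borel ((\<lambda>x. x) \<circ> (\<lambda>w. real (B (Suc j) w)))
      borel ((\<lambda>x. f (nat \<lfloor>x\<rfloor>)) \<circ> (\<lambda>w. \<Sum>t=1..j. real (B t w)))"
    by (rule indep_var_compose) measurable
  then have ind: "indep_var borel (\<lambda>w. real (B (Suc j) w)) borel (\<lambda>w. f (\<Sum>t=1..j. B t w))"
    by (simp add: o_def flip: of_nat_sum)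
  have m: "B t \<in> measurable M (count_space UNIV)" if "t \<in> {1..k}" for t
    using indep that by (simp add: indep_vars_def)
  show ?thesis
  proof (rule indep_var_lebesgue_integral[OF ind])
    show "integrable M (\<lambda>w. real (B (Suc j) w))"
      using j m B by (intro integrable_bounded_nat[where N = 1]) auto
    show "integrable M (\<lambda>w. f (\<Sum>t=1..j. B t w))"
    proof (rule integrable_bounded_nat[where N = j])
      show "(\<lambda>w. \<Sum>t=1..j. B t w) \<in> measurable M (count_space UNIV)"
        using j m by (intro sum_nat_measurable) auto
      show "(\<Sum>t=1..j. B t w) \<le> j" if "w \<in> space M" for w
        using sum_bounded_above[of "{1..j}" "\<lambda>t. B t w" 1] B that j by auto
    qed
  qed
qed

text \<open>Induction on the number of draws. The next draw raises the mean of \<open>g\<close> by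
  \<open>s / k\<close> times the mean increment at the current sum, and the tangent hypothesis makes
  this at least \<open>1 / k\<close> of the remaining gap.\<close>

lemma expectation_gap_contraction:
  fixes B :: "nat \<Rightarrow> 'a \<Rightarrow> nat" and g :: "nat \<Rightarrow> real"
  assumes k: "k \<ge> 1"
    and indep: "indep_vars (\<lambda>_. count_space UNIV) B {1..k}"
    and B: "\<And>t w. t \<in> {1..k} \<Longrightarrow> w \<in> space M \<Longrightarrow> B t w \<in> {0, 1}"
    and mean: "\<And>t. t \<in> {1..k} \<Longrightarrow> expectation (\<lambda>w. real (B t w)) = s / real k"
    and g0: "g 0 = 0"
    and tangent: "\<And>r. r < k \<Longrightarrow> Y \<le> g r + s * (g (Suc r) - g r)"
    and j: "j \<le> k"
  shows "Y - expectation (\<lambda>w. g (\<Sum>t=1..j. B t w)) \<le> (1 - 1 / real k) ^ j * Y"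
  using j
proof (induction j)
  case 0
  then show ?case
    by (simp add: g0 prob_space)
next
  case (Suc j)
  define X where "X w = (\<Sum>t=1..j. B t w)" for w
  define D where "D r = g (Suc r) - g r" for r
  have m: "B t \<in> measurable M (count_space UNIV)" if "t \<in> {1..k}" for t
    using indep that by (simp add: indep_vars_def)
  have B1: "B t w \<le> 1" if "t \<in> {1..k}" "w \<in> space M" for t w
    using B[OF that] by auto
  have X: "X \<in> measurable M (count_space UNIV)"
    unfolding X_def using Suc.prems m by (intro sum_nat_measurable) auto
  have Xle: "X w \<le> j" if "w \<in> space M" for w
    using sum_bounded_above[of "{1..j}" "\<lambda>t. B t w" 1] B1 that Suc.prems
    by (auto simp: X_def)
  have intX: "integrable M (\<lambda>w. f (X w))" for f :: "nat \<Rightarrow> real"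
    using X Xle by (rule integrable_bounded_nat)
  have intB: "integrable M (\<lambda>w. real (B (Suc j) w) * D (X w))"
  proof (rule Bochner_Integration.integrable_bound[OF intX[of D]])
    show "(\<lambda>w. real (B (Suc j) w) * D (X w)) \<in> borel_measurable M"
      using X m[of "Suc j"] Suc.prems by auto
    show "AE w in M. norm (real (B (Suc j) w) * D (X w)) \<le> norm (D (X w))"
      using B1[of "Suc j"] Suc.prems
      by (intro AE_I2) (auto simp: abs_mult intro!: mult_left_le_one_le)
  qed
  \<comment> \<open>The next indicator is 0 or 1, so adding it to the sum raises \<open>g\<close> by
    exactly that indicator times \<open>D\<close>.\<close>
  have "expectation (\<lambda>w. g (\<Sum>t=1..Suc j. B t w))
      = expectation (\<lambda>w. g (X w) + real (B (Suc j) w) * D (X w))"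
  proof (rule Bochner_Integration.integral_cong[OF refl])
    fix w assume "w \<in> space M"
    then show "g (\<Sum>t=1..Suc j. B t w) = g (X w) + real (B (Suc j) w) * D (X w)"
      using B[of "Suc j" w] Suc.prems by (auto simp: X_def D_def)
  qed
  also have "\<dots> = expectation (\<lambda>w. g (X w)) + s / real k * expectation (\<lambda>w. D (X w))"
    using indep_partial_sum[OF indep, of j D] mean[of "Suc j"] B1 Suc.prems intX intB
    by (simp add: X_def)
  finally have step: "expectation (\<lambda>w. g (\<Sum>t=1..Suc j. B t w))
      = expectation (\<lambda>w. g (X w)) + s * expectation (\<lambda>w. D (X w)) / real k"
    by simp
  \<comment> \<open>The tangent bound is averaged over \<open>X\<close>; it is available at every
    value because \<open>X\<close> is at most \<open>j\<close>, which is below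
    \<open>k\<close>.\<close>
  have "Y = expectation (\<lambda>w. Y)"
    by (simp add: prob_space)
  also have "\<dots> \<le> expectation (\<lambda>w. g (X w) + s * D (X w))"
  proof (rule integral_mono)
    show "integrable M (\<lambda>w. g (X w) + s * D (X w))"
      using intX[of "\<lambda>r. g r + s * D r"] .
    show "Y \<le> g (X w) + s * D (X w)" if "w \<in> space M" for w
      using tangent[of "X w"] Xle[OF that] Suc.prems by (simp add: D_def)
  qed auto
  also have "\<dots> = expectation (\<lambda>w. g (X w)) + s * expectation (\<lambda>w. D (X w))"
    using intX by simp
  finally have "(Y - expectation (\<lambda>w. g (X w))) / real k
      \<le> s * expectation (\<lambda>w. D (X w)) / real k"
    using k by (intro divide_right_mono) auto
  then have "Y - expectation (\<lambda>w. g (\<Sum>t=1..Suc j. B t w))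
      \<le> (1 - 1 / real k) * (Y - expectation (\<lambda>w. g (X w)))"
    unfolding step by (simp add: algebra_simps diff_divide_distrib)
  also have "\<dots> \<le> (1 - 1 / real k) * ((1 - 1 / real k) ^ j * Y)"
    using Suc.IH Suc.prems k by (intro mult_left_mono) (auto simp: X_def)
  finally show ?case
    by (simp add: mult.assoc)
qed

text \<open>The linear part of the objective, \<open>d\<close> times the sum of the
  \<open>y l\<close>, is at most \<open>d * s\<close>, which is exactly the mean of the linear part
  of the curve. Only the remainder \<open>Y\<close> loses the factor \<open>1 / e\<close>.\<close>

lemma PL_psi_rounding:
  fixes B :: "nat \<Rightarrow> 'a \<Rightarrow> nat" and y :: "nat \<Rightarrow> real"
  assumes lam: "lam \<ge> 1" and k: "k \<ge> 1"
    and indep: "indep_vars (\<lambda>_. count_space UNIV) B {1..k}"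
    and B: "\<And>t w. t \<in> {1..k} \<Longrightarrow> w \<in> space M \<Longrightarrow> B t w \<in> {0, 1}"
    and mean: "\<And>t. t \<in> {1..k} \<Longrightarrow> expectation (\<lambda>w. real (B t w)) = s / real k"
    and y: "\<And>l. l \<in> {1..k} \<Longrightarrow> 0 \<le> y l \<and> y l \<le> 1" "(\<Sum>l=1..k. y l) \<le> s"
  shows "(\<Sum>l=1..k. PL_d lam l k * y l) - 1 / exp 1 * PL_curvature lam k
    \<le> expectation (\<lambda>w. PL_psi lam k (\<Sum>t=1..k. B t w))"
proof -
  \<comment> \<open>The last increment is the largest slope whose removal keeps all the increments
    \<open>e l\<close> up to level \<open>k\<close> nonnegative.\<close>
  define d where "d = PL_d lam k k"
  define e where "e l = PL_d lam l k - d" for l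
  define Y where "Y = (\<Sum>l=1..k. e l * y l)"
  define g where "g r = (\<Sum>l=1..r. e l)" for r
  define X where "X w = (\<Sum>t=1..k. B t w)" for w
  have g: "g r = PL_psi lam k r - d * real r" for r
    using sum_PL_d[OF lam k, of r] by (simp add: g_def e_def sum_subtractf)
  have e0: "0 \<le> e l" if "1 \<le> l" "l \<le> k" for l
    using PL_d_antimono[OF lam k that] by (simp add: e_def d_def)
  have m: "B t \<in> measurable M (count_space UNIV)" if "t \<in> {1..k}" for t
    using indep that by (simp add: indep_vars_def)
  have B1: "B t w \<le> 1" if "t \<in> {1..k}" "w \<in> space M" for t w
    using B[OF that] by auto
  have intX: "integrable M (\<lambda>w. f (X w))" for f :: "nat \<Rightarrow> real"
  proof (rule integrable_bounded_nat[where N = k])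
    show "X \<in> measurable M (count_space UNIV)"
      unfolding X_def using m by (intro sum_nat_measurable) auto
    show "X w \<le> k" if "w \<in> space M" for w
      using sum_bounded_above[of "{1..k}" "\<lambda>t. B t w" 1] B1 that by (auto simp: X_def)
  qed
  have "Y \<le> g r + s * (g (Suc r) - g r)" if "r < k" for r
    using tangent_bound[of k e y s r] e0 y that PL_d_antimono[OF lam k]
    by (simp add: Y_def g_def e_def)
  then have "Y - expectation (\<lambda>w. g (X w)) \<le> (1 - 1 / real k) ^ k * Y"
    unfolding X_def using indep B mean k
    by (intro expectation_gap_contraction[where s = s]) (auto simp: g_def)
  moreover have "(1 - 1 / real k) ^ k * Y \<le> 1 / exp 1 * PL_curvature lam k"
  proof (rule mult_mono)
    show "(1 - 1 / real k) ^ k \<le> 1 / exp 1"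
      using k by (rule one_minus_inverse_power_le_exp)
    \<comment> \<open>Raising every \<open>y l\<close> to 1 can only increase \<open>Y\<close>, and
      the full sum telescopes to the value 1 of the curve at \<open>k\<close> minus
      \<open>k * d\<close>.\<close>
    have "Y \<le> (\<Sum>l=1..k. e l * 1)"
      unfolding Y_def using e0 y by (intro sum_mono mult_left_mono) auto
    also have "\<dots> = 1 - real k * d"
      using sum_PL_d[OF lam k, of k] PL_psi_full[OF lam k] by (simp add: e_def sum_subtractf)
    also have "\<dots> \<le> PL_curvature lam k"
      using one_minus_last_increments_le_curvature[OF lam k] by (simp add: d_def)
    finally show "Y \<le> PL_curvature lam k" .
    show "0 \<le> Y"
      unfolding Y_def using e0 y by (intro sum_nonneg mult_nonneg_nonneg) auto
  qed auto
  moreover have "(\<Sum>l=1..k. PL_d lam l k * y l) = d * (\<Sum>l=1..k. y l) + Y"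
    by (simp add: Y_def e_def sum_distrib_left algebra_simps flip: sum.distrib)
  moreover have "d * (\<Sum>l=1..k. y l) \<le> d * s"
    using y PL_d_pos[OF lam k, of k] k by (intro mult_left_mono) (auto simp: d_def)
  moreover have "expectation (\<lambda>w. real (X w)) = s"
  proof -
    have "expectation (\<lambda>w. real (X w)) = (\<Sum>t=1..k. expectation (\<lambda>w. real (B t w)))"
      unfolding X_def of_nat_sum using m B1
      by (intro Bochner_Integration.integral_sum integrable_bounded_nat[where N = 1]) auto
    then show ?thesis
      using mean k by simp
  qed
  then have "expectation (\<lambda>w. PL_psi lam k (X w)) = expectation (\<lambda>w. g (X w)) + d * s"
    using intX[of "PL_psi lam k"] intX[of real] by (simp add: g)
  ultimately show ?thesis
    by (simp add: X_def)
qed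

text \<open>Every \<open>X w\<close> lies in the finite set \<open>W\<close>, so
  \<open>f (X w)\<close> is a finite combination of indicators of the level sets of
  \<open>X\<close>.\<close>

lemma finite_range_expectation:
  fixes f :: "'g \<Rightarrow> real"
  assumes X: "X \<in> measurable M (count_space W)" and W: "finite W"
  shows "integrable M (\<lambda>w. f (X w))"
    and "expectation (\<lambda>w. f (X w)) = (\<Sum>g\<in>W. f g * prob {w \<in> space M. X w = g})"
proof -
  have ev: "{w \<in> space M. X w = g} \<in> events" if "g \<in> W" for g
    using measurable_sets[OF X, of "{g}"] that by (simp add: vimage_def Int_def conj_commute)
  have int: "integrable M (\<lambda>w. f g * indicator {w \<in> space M. X w = g} w)" if "g \<in> W" for g
    using ev[OF that]
    by (intro integrable_mult_right integrable_real_indicator) (auto simp flip: less_top)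
  have eq: "f (X w) = (\<Sum>g\<in>W. f g * indicator {w \<in> space M. X w = g} w)"
    if "w \<in> space M" for w
    using measurable_space[OF X that] W that by (simp add: indicator_def sum.delta if_distrib cong: if_cong)
  have "integrable M (\<lambda>w. \<Sum>g\<in>W. f g * indicator {w \<in> space M. X w = g} w)"
    using int by (rule Bochner_Integration.integrable_sum)
  then show "integrable M (\<lambda>w. f (X w))"
    using eq by (simp cong: Bochner_Integration.integrable_cong)
  have "expectation (\<lambda>w. f (X w))
      = expectation (\<lambda>w. \<Sum>g\<in>W. f g * indicator {w \<in> space M. X w = g} w)"
    using eq by (rule Bochner_Integration.integral_cong[OF refl])
  also have "\<dots> = (\<Sum>g\<in>W. f g * prob {w \<in> space M. X w = g})"
    using int ev by (simp add: Bochner_Integration.integral_sum)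
  finally show "expectation (\<lambda>w. f (X w)) = (\<Sum>g\<in>W. f g * prob {w \<in> space M. X w = g})" .
qed

end

section \<open>With-replacement rounding\<close>

text \<open>Grouping the draws by value or adding them one by one gives the same total. The general
  semiring covers both the correctness counts in \<open>nat\<close> and the real costs.\<close>

lemma sum_rr_vector:
  fixes f :: "'g \<Rightarrow> 'b :: comm_semiring_1"
  assumes "finite W" and "\<And>t. t \<in> {1..k} \<Longrightarrow> G t w \<in> W"
  shows "(\<Sum>g\<in>W. f g * of_nat (rr_vector k G w g)) = (\<Sum>t=1..k. f (G t w))"
proof -
  have "(\<Sum>g\<in>W. f g * of_nat (rr_vector k G w g))
      = (\<Sum>t=1..k. \<Sum>g\<in>W. f g * of_bool (G t w = g))"
    by (subst sum.swap) (simp only: rr_vector_def of_nat_sum sum_distrib_left of_nat_of_bool)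
  also have "\<dots> = (\<Sum>t=1..k. f (G t w))"
    using assms by (intro sum.cong refl) (simp add: of_bool_def sum.delta if_distrib cong: if_cong)
  finally show ?thesis .
qed

lemma wsize_rr_vector:
  assumes "finite W" and "\<And>t. t \<in> {1..k} \<Longrightarrow> G t w \<in> W"
  shows "wsize W (rr_vector k G w) = k"
  using sum_rr_vector[of W k G w "\<lambda>_. 1 :: nat"] assms by (simp add: wsize_def)

text \<open>The rounded vector has size \<open>k \<ge> 1\<close> and is therefore nonzero, which
  selects the nontrivial branch of \<open>net_value\<close>.\<close>

lemma net_value_rr_vector:
  assumes W: "finite W" and G: "\<And>t. t \<in> {1..k} \<Longrightarrow> G t w \<in> W" and k: "k \<ge> 1"
  shows "net_value n W a c lam \<gamma> (rr_vector k G w)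
    = 1 / real n * (\<Sum>i=1..n. PL_psi lam k (\<Sum>t=1..k. a i (G t w))) - \<gamma> * (\<Sum>t=1..k. c (G t w))"
proof -
  have size: "wsize W (rr_vector k G w) = k"
    using W G by (rule wsize_rr_vector)
  have "\<not> (\<forall>g\<in>W. rr_vector k G w g = 0)"
  proof
    assume "\<forall>g\<in>W. rr_vector k G w g = 0"
    then have "wsize W (rr_vector k G w) = 0"
      by (simp add: wsize_def)
    with size k show False
      by simp
  qed
  moreover have "num_correct W a i (rr_vector k G w) = (\<Sum>t=1..k. a i (G t w))" for i
    using sum_rr_vector[of W k G w "a i"] W G by (simp add: num_correct_def)
  moreover have "wcost W c (rr_vector k G w) = (\<Sum>t=1..k. c (G t w))"
    using sum_rr_vector[of W k G w c] W G by (simp add: wcost_def)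
  ultimately show ?thesis
    using size unfolding net_value_def PL_psi_eq_PL_h[OF k] by (simp only: if_False)
qed

context prob_space
begin

text \<open>Independence includes measurability into \<open>count_space W\<close>, which confines
  the draws to \<open>W\<close> at every sample point, not only almost surely.\<close>

lemma rr_draws_range:
  assumes "rr_draws M W k z G" "t \<in> {1..k}" "w \<in> space M"
  shows "G t w \<in> W"
proof -
  have "G t \<in> measurable M (count_space W)"
    using assms by (simp add: rr_draws_def indep_vars_def)
  from measurable_space[OF this assms(3)] show ?thesis
    by simp
qed

text \<open>For each task the indicators \<open>a i (G t w)\<close> are independent with mean
  \<open>s / k\<close>, where \<open>s\<close> is the right side of the task's LP constraint, so the
  single-task bound applies. The cost is linear in the draws, and its mean equals the LP
  cost.\<close>

lemma LP_rounding:
  assumes W: "finite W"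
    and a: "\<forall>i\<in>{1..n}. \<forall>g\<in>W. a i g \<in> {0, 1}"
    and lam: "lam \<ge> 1" and k: "k \<ge> 1" and n: "n \<ge> 1"
    and feas: "LP_feasible n W a k (y, z)"
    and draws: "rr_draws M W k z G"
  shows "integrable M (\<lambda>w. net_value n W a c lam \<gamma> (rr_vector k G w))" (is ?int)
    and "LP_objective n W c lam \<gamma> k (y, z) - 1 / exp 1 * PL_curvature lam k
      \<le> expectation (\<lambda>w. net_value n W a c lam \<gamma> (rr_vector k G w))" (is ?bound)
proof -
  define B where "B i t w = a i (G t w)" for i t w
  define \<epsilon> where "\<epsilon> = 1 / exp 1 * PL_curvature lam k"
  define p where "p i = (\<Sum>l=1..k. PL_d lam l k * y i l)" for i
  define E where "E i = expectation (\<lambda>w. PL_psi lam k (\<Sum>t=1..k. B i t w))" for i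
  have indep: "indep_vars (\<lambda>_. count_space W) G {1..k}"
    and law: "\<And>t g. t \<in> {1..k} \<Longrightarrow> g \<in> W \<Longrightarrow> prob {w \<in> space M. G t w = g} = z g / real k"
    using draws by (auto simp: rr_draws_def)
  have G: "G t \<in> measurable M (count_space W)" if "t \<in> {1..k}" for t
    using indep that by (simp add: indep_vars_def)
  note range = rr_draws_range[OF draws]
  have mean: "expectation (\<lambda>w. f (G t w)) = (\<Sum>g\<in>W. f g * z g) / real k"
    if "t \<in> {1..k}" for f :: "'b \<Rightarrow> real" and t
    using finite_range_expectation(2)[OF G[OF that] W] law[OF that] by (simp add: sum_divide_distrib)
  have net: "net_value n W a c lam \<gamma> (rr_vector k G w)
      = 1 / real n * (\<Sum>i=1..n. PL_psi lam k (\<Sum>t=1..k. B i t w)) - \<gamma> * (\<Sum>t=1..k. c (G t w))"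
    if "w \<in> space M" for w
    unfolding B_def using W range that k by (intro net_value_rr_vector) auto
  have indepB: "indep_vars (\<lambda>_. count_space UNIV) (B i) {1..k}" for i
    unfolding B_def by (rule indep_vars_compose2[OF indep]) auto
  have B: "B i t w \<in> {0, 1}" if "i \<in> {1..n}" "t \<in> {1..k}" "w \<in> space M" for i t w
    using a range that by (auto simp: B_def)
  have intpsi: "integrable M (\<lambda>w. PL_psi lam k (\<Sum>t=1..k. B i t w))" if i: "i \<in> {1..n}" for i
  proof (rule integrable_bounded_nat[where N = k])
    show "(\<lambda>w. \<Sum>t=1..k. B i t w) \<in> measurable M (count_space UNIV)"
      using indepB[of i] by (intro sum_nat_measurable) (simp add: indep_vars_def)
    show "(\<Sum>t=1..k. B i t w) \<le> k" if "w \<in> space M" for w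
      using sum_bounded_above[of "{1..k}" "\<lambda>t. B i t w" 1] B[OF i _ that] by fastforce
  qed
  have intc: "integrable M (\<lambda>w. c (G t w))" if "t \<in> {1..k}" for t
    using G[OF that] W by (rule finite_range_expectation(1))
  have int: "integrable M (\<lambda>w. 1 / real n * (\<Sum>i=1..n. PL_psi lam k (\<Sum>t=1..k. B i t w)))"
    "integrable M (\<lambda>w. \<gamma> * (\<Sum>t=1..k. c (G t w)))"
    using intpsi intc by (auto intro!: Bochner_Integration.integrable_sum)
  from Bochner_Integration.integrable_diff[OF this] show ?int
    using net by (simp cong: Bochner_Integration.integrable_cong)
  have "expectation (\<lambda>w. net_value n W a c lam \<gamma> (rr_vector k G w))
      = expectation (\<lambda>w. 1 / real n * (\<Sum>i=1..n. PL_psi lam k (\<Sum>t=1..k. B i t w))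
          - \<gamma> * (\<Sum>t=1..k. c (G t w)))"
    using net by (rule Bochner_Integration.integral_cong[OF refl])
  also have "\<dots> = 1 / real n * (\<Sum>i=1..n. E i) - \<gamma> * (\<Sum>t=1..k. expectation (\<lambda>w. c (G t w)))"
    using int intpsi intc
    by (simp only: Bochner_Integration.integral_diff E_def)
       (simp add: Bochner_Integration.integral_sum)
  also have "(\<Sum>t=1..k. expectation (\<lambda>w. c (G t w))) = (\<Sum>g\<in>W. c g * z g)"
    using mean[of _ c] k by simp
  finally have expect: "expectation (\<lambda>w. net_value n W a c lam \<gamma> (rr_vector k G w))
      = 1 / real n * (\<Sum>i=1..n. E i) - \<gamma> * (\<Sum>g\<in>W. c g * z g)" .
  have "p i - \<epsilon> \<le> E i" if i: "i \<in> {1..n}" for i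
    unfolding p_def \<epsilon>_def E_def
  proof (rule PL_psi_rounding[OF lam k indepB B[OF i]])
    show "expectation (\<lambda>w. real (B i t w)) = (\<Sum>g\<in>W. real (a i g) * z g) / real k"
      if "t \<in> {1..k}" for t
      using mean[OF that] by (simp add: B_def)
  qed (use feas i in \<open>auto simp: LP_feasible_def\<close>)
  then have "(\<Sum>i=1..n. p i - \<epsilon>) \<le> (\<Sum>i=1..n. E i)"
    by (rule sum_mono)
  then have "1 / real n * ((\<Sum>i=1..n. p i) - real n * \<epsilon>) \<le> 1 / real n * (\<Sum>i=1..n. E i)"
    by (intro mult_left_mono) (auto simp: sum_subtractf)
  \<comment> \<open>The \<open>n\<close> equal losses average to a single
    \<open>\<epsilon>\<close>.\<close>
  then have "1 / real n * (\<Sum>i=1..n. p i) - \<epsilon> \<le> 1 / real n * (\<Sum>i=1..n. E i)"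
    using n by (simp add: right_diff_distrib diff_divide_distrib)
  then show ?bound
    unfolding expect by (simp add: LP_objective_def p_def \<epsilon>_def)
qed

end

text \<open>The canonical model is the \<open>k\<close>-fold product of the law
  \<open>z / k\<close>, with the coordinates as draws. It serves the exact integer programs, where
  no probability space is given in advance.\<close>

lemma rr_draws_exist:
  fixes z :: "'g \<Rightarrow> real"
  assumes W: "finite W" and z: "\<forall>g\<in>W. 0 \<le> z g" "(\<Sum>g\<in>W. z g) = real k" and k: "k \<ge> 1"
  obtains P :: "(nat \<Rightarrow> 'g) measure" and G where "prob_space P" "rr_draws P W k z G"
proof -
  define Q where "Q = point_measure W (\<lambda>g. ennreal (z g / real k))"
  define P where "P = PiM {1..k} (\<lambda>_. Q)"
  have space: "space Q = W" and sets: "sets Q = Pow W"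
    by (simp_all add: Q_def space_point_measure sets_point_measure)
  have nonneg: "0 \<le> z g / real k" if "g \<in> W" for g
    using z that by simp
  interpret Q: prob_space Q
  proof
    have "emeasure Q W = (\<Sum>g\<in>W. ennreal (z g / real k))"
      unfolding Q_def using W by (rule emeasure_point_measure_finite) simp
    also have "\<dots> = ennreal ((\<Sum>g\<in>W. z g) / real k)"
      using nonneg by (simp add: sum_ennreal sum_divide_distrib)
    finally show "emeasure Q (space Q) = 1"
      using z k by (simp add: space)
  qed
  interpret P: prob_space P
    unfolding P_def by (rule prob_space_PiM) (rule Q.prob_space_axioms)
  have proj: "(\<lambda>w. w t) \<in> measurable P Q" and dist: "distr P Q (\<lambda>w. w t) = Q"
    if "t \<in> {1..k}" for t
    unfolding P_def using that Q.prob_space_axioms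
    by (auto intro: distr_PiM_component measurable_component_singleton)
  have "P.indep_vars (\<lambda>_. Q) (\<lambda>t w. w t) {1..k}"
  proof (subst P.indep_vars_iff_distr_eq_PiM')
    \<comment> \<open>Points of the product space are extensional, so restriction to
      \<open>{1..k}\<close> is the identity there; what remains is that \<open>P\<close> is the
      product of its marginals.\<close>
    have "distr P P (\<lambda>w. \<lambda>t\<in>{1..k}. w t) = distr P P (\<lambda>w. w)"
      by (rule distr_cong) (auto simp: P_def space_PiM PiE_def extensional_restrict)
    also have "\<dots> = P"
      by (rule distr_id)
    also have "P = PiM {1..k} (\<lambda>t. distr P Q (\<lambda>w. w t))"
      by (subst P_def, rule PiM_cong) (simp_all add: dist)
    finally show "distr P (PiM {1..k} (\<lambda>_. Q)) (\<lambda>w. \<lambda>t\<in>{1..k}. w t)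
        = PiM {1..k} (\<lambda>t. distr P Q (\<lambda>w. w t))"
      by (simp add: P_def)
  qed (use k proj in auto)
  then have "P.indep_vars (\<lambda>_. count_space W) (\<lambda>t w. w t) {1..k}"
    by (rule P.indep_vars_compose2[where Y = "\<lambda>_ g. g"])
       (auto simp: measurable_def space sets)
  moreover have "measure P {w \<in> space P. w t = g} = z g / real k"
    if "t \<in> {1..k}" "g \<in> W" for t g
  proof -
    have "measure P {w \<in> space P. w t = g} = measure (distr P Q (\<lambda>w. w t)) {g}"
      using proj that by (subst measure_distr) (auto simp: sets intro: arg_cong[where f = "measure P"])
    also have "\<dots> = z g / real k"
      using that nonneg W dist by (simp add: Q_def measure_point_measure_finite_if)
    finally show ?thesis .
  qed
  ultimately have "rr_draws P W k z (\<lambda>t w. w t)"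
    by (simp add: rr_draws_def)
  then show thesis
    using that P.prob_space_axioms by blast
qed

section \<open>From the linear program to the integer program\<close>

text \<open>The whole weight \<open>k\<close> goes to one workflow and \<open>y\<close> is zero.
  Nonemptiness is what allows the supremum \<open>LP_value\<close> to be bounded from above.\<close>

lemma LP_feasible_exists:
  assumes "finite W" "W \<noteq> {}"
  shows "\<exists>yz. LP_feasible n W a k yz"
proof -
  obtain g where "g \<in> W"
    using assms by auto
  then have "LP_feasible n W a k (\<lambda>_ _. 0, \<lambda>g'. if g' = g then real k else 0)"
    using assms by (auto simp: LP_feasible_def intro!: sum_nonneg)
  then show ?thesis ..
qed

lemma LP_value_eq_optimal:
  assumes "LP_optimal n W a c lam \<gamma> k yz"
  shows "LP_value n W a c lam \<gamma> k = LP_objective n W c lam \<gamma> k yz"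
  unfolding LP_value_def using assms
  by (intro cSup_eq_maximum) (auto simp: LP_optimal_def is_arg_max_def not_less)

text \<open>Probabilistic method: the rounding of any feasible point always has size
  \<open>k\<close>, so its mean value cannot exceed the integer optimum. Holding at every feasible
  point, the bound passes to the supremum without reference to an LP optimizer.\<close>

lemma LP_value_le_integer_optimum:
  fixes W :: "'g set"
  assumes W: "finite W" "W \<noteq> {}"
    and a: "\<forall>i\<in>{1..n}. \<forall>g\<in>W. a i g \<in> {0, 1}"
    and lam: "lam \<ge> 1" and k: "k \<ge> 1" and n: "n \<ge> 1"
    and opt: "is_arg_max (net_value n W a c lam \<gamma>) (\<lambda>m. wsize W m = k) m"
  shows "LP_value n W a c lam \<gamma> k - 1 / exp 1 * PL_curvature lam k \<le> net_value n W a c lam \<gamma> m"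
proof -
  have "LP_objective n W c lam \<gamma> k yz \<le> net_value n W a c lam \<gamma> m + 1 / exp 1 * PL_curvature lam k"
    if feas: "LP_feasible n W a k yz" for yz
  proof (cases yz)
    case (Pair y z)
    have "\<forall>g\<in>W. 0 \<le> z g" "(\<Sum>g\<in>W. z g) = real k"
      using feas by (auto simp: Pair LP_feasible_def)
    then obtain P :: "(nat \<Rightarrow> 'g) measure" and G
      where "prob_space P" and draws: "rr_draws P W k z G"
      using W k by (elim rr_draws_exist)
    interpret prob_space P by fact
    note round = LP_rounding[OF W(1) a lam k n feas[unfolded Pair] draws]
    have "LP_objective n W c lam \<gamma> k (y, z) - 1 / exp 1 * PL_curvature lam k
        \<le> expectation (\<lambda>w. net_value n W a c lam \<gamma> (rr_vector k G w))"
      by (rule round)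
    also have "\<dots> \<le> expectation (\<lambda>_. net_value n W a c lam \<gamma> m)"
    proof (rule integral_mono[OF round(1)])
      fix w assume "w \<in> space P"
      then have "wsize W (rr_vector k G w) = k"
        using W rr_draws_range[OF draws] by (intro wsize_rr_vector) auto
      then show "net_value n W a c lam \<gamma> (rr_vector k G w) \<le> net_value n W a c lam \<gamma> m"
        using opt by (auto simp: is_arg_max_def not_less)
    qed auto
    finally show ?thesis
      by (simp add: Pair prob_space)
  qed
  then have "LP_value n W a c lam \<gamma> k
      \<le> net_value n W a c lam \<gamma> m + 1 / exp 1 * PL_curvature lam k"
    unfolding LP_value_def using LP_feasible_exists[OF W] by (intro cSup_least) auto
  then show ?thesis
    by simp
qed

section \<open>Combining the grid sizes with the baseline\<close>

lemma max_ge_mult_ratio: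
  fixes U V \<epsilon> :: real
  assumes "V > 0" "\<epsilon> \<ge> 0"
  shows "V / (V + \<epsilon>) * U \<le> max V (U - \<epsilon>)"
\<comment> \<open>The two terms of the maximum coincide at \<open>U = V + \<epsilon>\<close>. Beyond
  that point \<open>U - \<epsilon>\<close> suffices, since
  \<open>(U - \<epsilon>) * (V + \<epsilon>)\<close> exceeds \<open>V * U\<close> by
  \<open>\<epsilon> * (U - V - \<epsilon>)\<close>.\<close>
proof (cases "U \<le> V + \<epsilon>")
  case True
  then have "V * U \<le> V * (V + \<epsilon>)"
    using assms by (intro mult_left_mono) auto
  then have "V / (V + \<epsilon>) * U \<le> V"
    using assms by (simp add: divide_le_eq)
  then show ?thesis
    by simp
next
  case False
  then have "\<epsilon> * (U - V - \<epsilon>) \<ge> 0"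
    using assms by (intro mult_nonneg_nonneg) auto
  then have "V * U \<le> (U - \<epsilon>) * (V + \<epsilon>)"
    by (simp add: algebra_simps)
  then have "V / (V + \<epsilon>) * U \<le> U - \<epsilon>"
    using assms by (simp add: divide_le_eq)
  then show ?thesis
    by simp
qed

text \<open>Common last step of both guarantees: \<open>x\<close> is the expected value in the
  randomized case and the value of the chosen vector in the exact case. Monotone curvature bounds
  the loss of each size by that of \<open>Max K\<close>, and the entry 0 in \<open>U_LP\<close> is
  covered by \<open>x > 0\<close>.\<close>

lemma max_U_LP_le:
  assumes lam: "lam \<ge> 1" and K: "finite K" "K \<noteq> {}" "\<And>k. k \<in> K \<Longrightarrow> 1 \<le> k"
    and V: "V > 0" "V \<le> x"
    and LP: "\<And>k. k \<in> K \<Longrightarrow> LP_value n W a c lam \<gamma> k - 1 / exp 1 * PL_curvature lam k \<le> x"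
  shows "max V (U_LP n a c lam \<gamma> K W - rounding_loss K lam) \<le> x"
proof -
  have curv: "1 / exp 1 * PL_curvature lam k \<le> rounding_loss K lam" if "k \<in> K" for k
    unfolding rounding_loss_def using that K lam by (intro mult_left_mono PL_curvature_mono) auto
  have "LP_value n W a c lam \<gamma> k \<le> x + rounding_loss K lam" if "k \<in> K" for k
    using LP[OF that] curv[OF that] by linarith
  then have "Max (LP_value n W a c lam \<gamma> ` K) \<le> x + rounding_loss K lam"
    using K by (subst Max_le_iff) auto
  moreover have "0 \<le> rounding_loss K lam"
    unfolding rounding_loss_def using lam K by (intro mult_nonneg_nonneg PL_curvature_nonneg) auto
  ultimately show ?thesis
    using V by (simp add: U_LP_def)
qed

theorem corollary2:
  fixes n K_max :: nat
    and M :: "'g set"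
    and a :: "nat \<Rightarrow> 'g \<Rightarrow> nat"
    and c :: "'g \<Rightarrow> real"
    and \<gamma> lam V :: real
    and K :: "nat set"
    and m0 :: "'g \<Rightarrow> nat"
  assumes "n \<ge> 1"
    and "finite M" and "M \<noteq> {}"
    and "\<forall>i\<in>{1..n}. \<forall>g\<in>M. a i g \<in> {0, 1}"
    and "\<forall>g\<in>M. c g \<ge> 0"
    and "\<gamma> \<ge> 0"
    and "K_max \<ge> 1"
    and "lam \<ge> 1"
    and "K \<subseteq> {1..K_max}" and "K \<noteq> {}"
    and "wsize M m0 \<le> K_max"
    and "net_value n M a c lam \<gamma> m0 \<ge> V" and "V > 0"
  shows
    "(\<forall>(P :: 'w measure) (y :: nat \<Rightarrow> nat \<Rightarrow> nat \<Rightarrow> real) (z :: nat \<Rightarrow> 'g \<Rightarrow> real)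
        (G :: nat \<Rightarrow> nat \<Rightarrow> 'w \<Rightarrow> 'g) (Mhat :: 'w \<Rightarrow> 'g \<Rightarrow> nat).
        prob_space P \<and>
        (\<forall>k\<in>K. LP_optimal n M a c lam \<gamma> k (y k, z k)) \<and>
        (\<forall>k\<in>K. rr_draws P M k (z k) (G k)) \<and>
        (\<forall>w\<in>space P. is_arg_max (net_value n M a c lam \<gamma>)
            (\<lambda>S. S \<in> {m0} \<union> {rr_vector k (G k) w | k. k \<in> K}) (Mhat w))
        \<longrightarrow> prob_space.expectation P (\<lambda>w. net_value n M a c lam \<gamma> (Mhat w))
              \<ge> max V (U_LP n a c lam \<gamma> K M - rounding_loss K lam))
     \<and> (\<forall>(N :: nat \<Rightarrow> 'g \<Rightarrow> nat) (mhat :: 'g \<Rightarrow> nat).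
        (\<forall>k\<in>K. is_arg_max (net_value n M a c lam \<gamma>) (\<lambda>m. wsize M m = k) (N k)) \<and>
        is_arg_max (net_value n M a c lam \<gamma>) (\<lambda>S. S \<in> {m0} \<union> {N k | k. k \<in> K}) mhat
        \<longrightarrow> net_value n M a c lam \<gamma> mhat
              \<ge> max V (U_LP n a c lam \<gamma> K M - rounding_loss K lam))
     \<and> max V (U_LP n a c lam \<gamma> K M - rounding_loss K lam)
         \<ge> V / (V + rounding_loss K lam) * U_LP n a c lam \<gamma> K M"
proof -
  let ?net = "net_value n M a c lam \<gamma>"
  note n = \<open>n \<ge> 1\<close> and W = \<open>finite M\<close> \<open>M \<noteq> {}\<close> and lam = \<open>lam \<ge> 1\<close>
    and a = \<open>\<forall>i\<in>{1..n}. \<forall>g\<in>M. a i g \<in> {0, 1}\<close> and V = \<open>V > 0\<close> \<open>?net m0 \<ge> V\<close>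
  have K: "finite K" "K \<noteq> {}" and K1: "\<And>k. k \<in> K \<Longrightarrow> 1 \<le> k"
    using \<open>K \<subseteq> {1..K_max}\<close> \<open>K \<noteq> {}\<close> by (auto intro: finite_subset)
  have rounding: "max V (U_LP n a c lam \<gamma> K M - rounding_loss K lam)
      \<le> prob_space.expectation P (\<lambda>w. ?net (Mhat w))"
    if "prob_space P"
      and opt: "\<forall>k\<in>K. LP_optimal n M a c lam \<gamma> k (y k, z k)"
      and draws: "\<forall>k\<in>K. rr_draws P M k (z k) (G k)"
      and Mhat: "\<forall>w\<in>space P. is_arg_max ?net
            (\<lambda>S. S \<in> {m0} \<union> {rr_vector k (G k) w | k. k \<in> K}) (Mhat w)"
    for P :: "'w measure" and y :: "nat \<Rightarrow> nat \<Rightarrow> nat \<Rightarrow> real" and z :: "nat \<Rightarrow> 'g \<Rightarrow> real"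
      and G :: "nat \<Rightarrow> nat \<Rightarrow> 'w \<Rightarrow> 'g" and Mhat :: "'w \<Rightarrow> 'g \<Rightarrow> nat"
  proof -
    interpret prob_space P by fact
    have feas: "LP_feasible n M a k (y k, z k)" if "k \<in> K" for k
      using opt that by (simp add: LP_optimal_def is_arg_max_def)
    have int: "integrable P (\<lambda>w. ?net (rr_vector k (G k) w))" if "k \<in> K" for k
      using LP_rounding(1)[OF W(1) a lam K1[OF that] n feas[OF that]] draws that by blast
    \<comment> \<open>\<open>Mhat\<close> is an arbitrary pointwise maximizer, with no measurability
      assumed; its value nevertheless equals \<open>F\<close>, a finite maximum of measurable
      candidate values.\<close>
    define F where "F w = Max (insert (?net m0) ((\<lambda>k. ?net (rr_vector k (G k) w)) ` K))" for w
    have best: "?net m0 \<le> ?net (Mhat w)"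
        "\<And>k. k \<in> K \<Longrightarrow> ?net (rr_vector k (G k) w) \<le> ?net (Mhat w)"
        "Mhat w = m0 \<or> (\<exists>k\<in>K. Mhat w = rr_vector k (G k) w)" if "w \<in> space P" for w
      using Mhat that unfolding is_arg_max_def not_less by (auto simp: not_less)
    have F: "?net (Mhat w) = F w" if "w \<in> space P" for w
      unfolding F_def using best[OF that] K by (intro Max_eqI[symmetric]) auto
    have intF: "integrable P F"
    \<comment> \<open>At each sample point \<open>F\<close> is one of the candidate values, so the
      sum of all their absolute values dominates it.\<close>
    proof (rule Bochner_Integration.integrable_bound)
      show "integrable P (\<lambda>w. \<bar>?net m0\<bar> + (\<Sum>k\<in>K. \<bar>?net (rr_vector k (G k) w)\<bar>))"
        using int by (auto intro!: Bochner_Integration.integrable_add Bochner_Integration.integrable_sum)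
      show "F \<in> borel_measurable P"
        unfolding F_def using K int by simp
      have "\<bar>F w\<bar> \<le> \<bar>?net m0\<bar> + (\<Sum>k\<in>K. \<bar>?net (rr_vector k (G k) w)\<bar>)" for w
      proof -
        have "F w \<in> insert (?net m0) ((\<lambda>k. ?net (rr_vector k (G k) w)) ` K)"
          unfolding F_def using K by (intro Max_in) auto
        moreover have "\<bar>?net (rr_vector k (G k) w)\<bar> \<le> (\<Sum>k\<in>K. \<bar>?net (rr_vector k (G k) w)\<bar>)"
          if "k \<in> K" for k
          using K that by (intro member_le_sum) auto
        ultimately show ?thesis
          by (fastforce intro: sum_nonneg add_increasing)
      qed
      then show "AE w in P. norm (F w)
          \<le> norm (\<bar>?net m0\<bar> + (\<Sum>k\<in>K. \<bar>?net (rr_vector k (G k) w)\<bar>))"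
        by (intro AE_I2) (auto intro: order_trans)
    qed
    then have intM: "integrable P (\<lambda>w. ?net (Mhat w))"
      using F by (simp cong: Bochner_Integration.integrable_cong)
    \<comment> \<open>The choice made after rounding dominates every candidate at each sample point,
      so its expectation is compared with one candidate at a time.\<close>
    show ?thesis
    proof (rule max_U_LP_le[OF lam K K1 V(1)])
      have "V \<le> expectation (\<lambda>_. ?net m0)"
        using V by (simp add: prob_space)
      also have "\<dots> \<le> expectation (\<lambda>w. ?net (Mhat w))"
        using intM best by (intro integral_mono) auto
      finally show "V \<le> expectation (\<lambda>w. ?net (Mhat w))" .
    next
      fix k assume k: "k \<in> K"
      have "LP_value n M a c lam \<gamma> k - 1 / exp 1 * PL_curvature lam k
          = LP_objective n M c lam \<gamma> k (y k, z k) - 1 / exp 1 * PL_curvature lam k"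
        using opt k LP_value_eq_optimal by fastforce
      also have "\<dots> \<le> expectation (\<lambda>w. ?net (rr_vector k (G k) w))"
        using LP_rounding(2)[OF W(1) a lam K1[OF k] n feas[OF k]] draws k by blast
      also have "\<dots> \<le> expectation (\<lambda>w. ?net (Mhat w))"
        using int[OF k] intM best k by (intro integral_mono) auto
      finally show "LP_value n M a c lam \<gamma> k - 1 / exp 1 * PL_curvature lam k
          \<le> expectation (\<lambda>w. ?net (Mhat w))" .
    qed
  qed
  \<comment> \<open>The candidates are now deterministic: the integer optimum of each size already
    meets the LP bound, and the final choice is at least as good.\<close>
  have exact: "max V (U_LP n a c lam \<gamma> K M - rounding_loss K lam) \<le> ?net mhat"
    if N: "\<forall>k\<in>K. is_arg_max ?net (\<lambda>m. wsize M m = k) (N k)"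
      and mhat: "is_arg_max ?net (\<lambda>S. S \<in> {m0} \<union> {N k | k. k \<in> K}) mhat"
    for N :: "nat \<Rightarrow> 'g \<Rightarrow> nat" and mhat :: "'g \<Rightarrow> nat"
  proof (rule max_U_LP_le[OF lam K K1 V(1)])
    show "V \<le> ?net mhat"
      using V mhat by (force simp: is_arg_max_def not_less)
  next
    fix k assume k: "k \<in> K"
    have "LP_value n M a c lam \<gamma> k - 1 / exp 1 * PL_curvature lam k \<le> ?net (N k)"
      using N k by (intro LP_value_le_integer_optimum[OF W a lam K1[OF k] n]) auto
    also have "\<dots> \<le> ?net mhat"
      using mhat k unfolding is_arg_max_def not_less by (auto simp: not_less)
    finally show "LP_value n M a c lam \<gamma> k - 1 / exp 1 * PL_curvature lam k \<le> ?net mhat" .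
  qed
  have "0 \<le> rounding_loss K lam"
    unfolding rounding_loss_def using lam K K1 by (intro mult_nonneg_nonneg PL_curvature_nonneg) auto
  then have "V / (V + rounding_loss K lam) * U_LP n a c lam \<gamma> K M
      \<le> max V (U_LP n a c lam \<gamma> K M - rounding_loss K lam)"
    using V by (intro max_ge_mult_ratio)
  then show ?thesis
    using rounding exact by blast
qed

end
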